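(* Let $M$ be a smooth manifold, $f\in C^\infty(M)$ and $\theta$ a closed $1$-form on $M$. If $h\in C^\infty(M)$ does not vanish (at any point of $M$), then the cohomologies $H^\bullet_{f,\theta}(M)$ and $H^\bullet_{fh,\theta}(M)$ are isomorphic.
   Context: $\Omega^r(M)$ is the space of smooth real $r$-forms on $M$. For $f\in C^\infty(M)$, a closed $1$-form $\theta$, and $\varphi\in\Omega^r(M)$, put $d_f\varphi=f\,d\varphi-r\,df\wedge\varphi$ and $d_{f,\theta}\varphi=d_f\varphi-f\theta\wedge\varphi$. Then $d_{f,\theta}^2=0$, and $H^\bullet_{f,\theta}(M)$ is the cohomology of the complex $(\Omega^\bullet(M),d_{f,\theta})$. *)

theory Defs
  imports "HOL-Analysis.Analysis" "HOL-Library.Function_Algebras"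
begin

text \<open>
  Manifolds are modelled on a linear subspace \<open>V\<close> of a Euclidean type \<open>'e\<close>, not on \<open>'e\<close> itself:
  every Euclidean type has positive dimension, whereas \<open>V\<close> may have any dimension, including \<open>0\<close>.
  Accordingly \<open>C\<^sup>k\<close> maps on relatively open subsets of \<open>V\<close> are defined by iterated directional
  derivatives along \<open>V\<close>.
\<close>

definition dir_deriv :: "('e::real_normed_vector \<Rightarrow> 'b::real_normed_vector) \<Rightarrow> 'e \<Rightarrow> 'e \<Rightarrow> 'b" where
  "dir_deriv g x u = vector_derivative (\<lambda>t::real. g (x + t *\<^sub>R u)) (at 0)"

primrec Ck_on :: "nat \<Rightarrow> 'e set \<Rightarrow> 'e set \<Rightarrow>
    ('e::real_normed_vector \<Rightarrow> 'b::real_normed_vector) \<Rightarrow> bool" where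
  "Ck_on 0 V U g \<longleftrightarrow> continuous_on U g"
| "Ck_on (Suc k) V U g \<longleftrightarrow> continuous_on U g \<and>
     (\<forall>u\<in>V. (\<forall>x\<in>U. (\<lambda>t::real. g (x + t *\<^sub>R u)) differentiable (at 0)) \<and>
            Ck_on k V U (\<lambda>x. dir_deriv g x u))"

definition smooth_on :: "'e set \<Rightarrow> 'e set \<Rightarrow>
    ('e::real_normed_vector \<Rightarrow> 'b::real_normed_vector) \<Rightarrow> bool" where
  "smooth_on V U g \<longleftrightarrow> (\<forall>k. Ck_on k V U g)"

type_synonym ('a, 'e) chart = "'a set \<times> ('a \<Rightarrow> 'e)"

record ('a, 'e) manifold =
  mtop :: "'a topology"
  model :: "'e set"
  atlas :: "('a, 'e) chart set"

abbreviation dom :: "('a, 'e) chart \<Rightarrow> 'a set" where "dom c \<equiv> fst c"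

abbreviation img :: "('a, 'e) chart \<Rightarrow> 'e set" where "img c \<equiv> snd c ` fst c"

abbreviation param :: "('a, 'e) chart \<Rightarrow> 'e \<Rightarrow> 'a" where
  "param c \<equiv> inv_into (fst c) (snd c)"

definition overlap :: "('a, 'e) chart \<Rightarrow> ('a, 'e) chart \<Rightarrow> 'e set" where
  "overlap c c' = snd c ` (dom c \<inter> dom c')"

definition transition :: "('a, 'e) chart \<Rightarrow> ('a, 'e) chart \<Rightarrow> 'e \<Rightarrow> 'e" where
  "transition c c' = snd c' \<circ> param c"

definition smooth_manifold :: "('a, 'e::euclidean_space) manifold \<Rightarrow> bool" where
  "smooth_manifold M \<longleftrightarrow>
     Hausdorff_space (mtop M) \<and> second_countable (mtop M) \<and> subspace (model M) \<and>
     (\<forall>c\<in>atlas M. openin (mtop M) (dom c) \<and>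
        openin (top_of_set (model M)) (img c) \<and>
        homeomorphic_map (subtopology (mtop M) (dom c)) (top_of_set (img c)) (snd c)) \<and>
     (\<Union>c\<in>atlas M. dom c) = topspace (mtop M) \<and>
     (\<forall>c\<in>atlas M. \<forall>c'\<in>atlas M. smooth_on (model M) (overlap c c') (transition c c'))"

definition smooth_functions :: "('a, 'e::euclidean_space) manifold \<Rightarrow> ('a \<Rightarrow> real) set" where
  "smooth_functions M = {f. \<forall>c\<in>atlas M. smooth_on (model M) (img c) (f \<circ> param c)}"

text \<open>
  As in Bott and Tu, a differential form on \<open>M\<close> is a family of differential forms on the chart
  images, compatible under pullback along the transition maps. For a form \<open>\<omega>\<close>, the number
  \<open>\<omega> c x us\<close> is the value of the local representative in the chart \<open>c\<close>, at the coordinate point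
  \<open>x\<close>, on the list \<open>us\<close> of tangent vectors (in \<open>model M\<close>). The value is required to be \<open>0\<close> for
  arguments that make no sense, so that equality of forms is equality of functions.
\<close>

type_synonym ('a, 'e) form = "('a, 'e) chart \<Rightarrow> 'e \<Rightarrow> 'e list \<Rightarrow> real"

definition valid_args :: "('a, 'e) manifold \<Rightarrow> ('a, 'e) chart \<Rightarrow> 'e \<Rightarrow> 'e list \<Rightarrow> bool" where
  "valid_args M c x us \<longleftrightarrow> c \<in> atlas M \<and> x \<in> img c \<and> set us \<subseteq> model M"

definition omit :: "nat \<Rightarrow> 'e list \<Rightarrow> 'e list" where
  "omit i us = take i us @ drop (Suc i) us"

definition alternating_multilinear ::
    "'e::real_vector set \<Rightarrow> nat \<Rightarrow> ('e list \<Rightarrow> real) \<Rightarrow> bool" where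
  "alternating_multilinear V r \<alpha> \<longleftrightarrow>
     (\<forall>us i v w a b. length us = r \<and> set us \<subseteq> V \<and> i < r \<and> v \<in> V \<and> w \<in> V \<longrightarrow>
        \<alpha> (us[i := a *\<^sub>R v + b *\<^sub>R w]) = a * \<alpha> (us[i := v]) + b * \<alpha> (us[i := w])) \<and>
     (\<forall>us i j. length us = r \<and> set us \<subseteq> V \<and> i < j \<and> j < r \<and> us ! i = us ! j \<longrightarrow> \<alpha> us = 0)"

definition forms :: "('a, 'e::euclidean_space) manifold \<Rightarrow> nat \<Rightarrow> ('a, 'e) form set" where
  "forms M r = {\<omega>.
     (\<forall>c x us. \<not> (valid_args M c x us \<and> length us = r) \<longrightarrow> \<omega> c x us = 0) \<and>
     (\<forall>c\<in>atlas M. \<forall>x\<in>img c. alternating_multilinear (model M) r (\<omega> c x)) \<and>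
     (\<forall>c\<in>atlas M. \<forall>us. length us = r \<and> set us \<subseteq> model M \<longrightarrow>
        smooth_on (model M) (img c) (\<lambda>x. \<omega> c x us)) \<and>
     (\<forall>c\<in>atlas M. \<forall>c'\<in>atlas M. \<forall>x\<in>overlap c c'. \<forall>us. length us = r \<and> set us \<subseteq> model M \<longrightarrow>
        \<omega> c x us = \<omega> c' (transition c c' x) (map (dir_deriv (transition c c') x) us))}"

definition fun_form :: "('a, 'e) manifold \<Rightarrow> ('a \<Rightarrow> real) \<Rightarrow> ('a, 'e) form" where
  "fun_form M f = (\<lambda>c x us. if valid_args M c x us \<and> us = [] then f (param c x) else 0)"

definition fun_mult :: "('a \<Rightarrow> real) \<Rightarrow> ('a, 'e) form \<Rightarrow> ('a, 'e) form" where
  "fun_mult f \<omega> = (\<lambda>c x us. f (param c x) * \<omega> c x us)"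

abbreviation form_scale :: "real \<Rightarrow> ('a, 'e) form \<Rightarrow> ('a, 'e) form" where
  "form_scale a \<equiv> fun_mult (\<lambda>_. a)"

text \<open>
  The wedge product with a \<open>1\<close>-form on the left, and the exterior derivative, in the normalisation
  without factorials: \<open>(\<alpha> \<and> \<omega>)(u\<^sub>0, \<dots>, u\<^sub>r) = \<Sum>\<^sub>i (-1)\<^sup>i \<alpha>(u\<^sub>i) \<omega>(\<dots>, u\<^sub>i omitted, \<dots>)\<close>. In \<open>ext_d\<close> the
  \<open>u\<^sub>i\<close> are constant vector fields in the chart, so the bracket terms of the invariant formula
  vanish. Both definitions serve all degrees at once, as an \<open>r\<close>-form is \<open>0\<close> on lists of length other
  than \<open>r\<close>.
\<close>

definition wedge1 :: "('a, 'e) form \<Rightarrow> ('a, 'e) form \<Rightarrow> ('a, 'e) form" where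
  "wedge1 \<alpha> \<omega> = (\<lambda>c x us. \<Sum>i<length us. (- 1) ^ i * \<alpha> c x [us ! i] * \<omega> c x (omit i us))"

definition ext_d :: "('a, 'e::euclidean_space) manifold \<Rightarrow> ('a, 'e) form \<Rightarrow> ('a, 'e) form" where
  "ext_d M \<omega> = (\<lambda>c x us. if valid_args M c x us
     then \<Sum>i<length us. (- 1) ^ i * dir_deriv (\<lambda>y. \<omega> c y (omit i us)) x (us ! i)
     else 0)"

definition closed_form :: "('a, 'e::euclidean_space) manifold \<Rightarrow> nat \<Rightarrow> ('a, 'e) form \<Rightarrow> bool" where
  "closed_form M r \<omega> \<longleftrightarrow> \<omega> \<in> forms M r \<and> ext_d M \<omega> = 0"

definition d_f :: "('a, 'e::euclidean_space) manifold \<Rightarrow> ('a \<Rightarrow> real) \<Rightarrow> nat \<Rightarrow>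
    ('a, 'e) form \<Rightarrow> ('a, 'e) form" where
  "d_f M f r \<phi> = fun_mult f (ext_d M \<phi>) - form_scale (real r) (wedge1 (ext_d M (fun_form M f)) \<phi>)"

definition d_f_theta :: "('a, 'e::euclidean_space) manifold \<Rightarrow> ('a \<Rightarrow> real) \<Rightarrow> ('a, 'e) form \<Rightarrow> nat \<Rightarrow>
    ('a, 'e) form \<Rightarrow> ('a, 'e) form" where
  "d_f_theta M f \<theta> r \<phi> = d_f M f r \<phi> - fun_mult f (wedge1 \<theta> \<phi>)"

definition cocycles :: "('a, 'e::euclidean_space) manifold \<Rightarrow> ('a \<Rightarrow> real) \<Rightarrow> ('a, 'e) form \<Rightarrow> nat \<Rightarrow>
    ('a, 'e) form set" where
  "cocycles M f \<theta> r = {\<phi> \<in> forms M r. d_f_theta M f \<theta> r \<phi> = 0}"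

primrec coboundaries :: "('a, 'e::euclidean_space) manifold \<Rightarrow> ('a \<Rightarrow> real) \<Rightarrow> ('a, 'e) form \<Rightarrow> nat \<Rightarrow>
    ('a, 'e) form set" where
  "coboundaries M f \<theta> 0 = {0}"
| "coboundaries M f \<theta> (Suc r) = d_f_theta M f \<theta> r ` forms M r"

text \<open>Real vector spaces with an explicit carrier, and linear isomorphism between them.\<close>

record 'v vspace =
  vcarrier :: "'v set"
  vadd :: "'v \<Rightarrow> 'v \<Rightarrow> 'v"
  vscale :: "real \<Rightarrow> 'v \<Rightarrow> 'v"

definition vspace_iso :: "'v vspace \<Rightarrow> 'w vspace \<Rightarrow> bool" where
  "vspace_iso X Y \<longleftrightarrow> (\<exists>T. bij_betw T (vcarrier X) (vcarrier Y) \<and>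
     (\<forall>x\<in>vcarrier X. \<forall>y\<in>vcarrier X. T (vadd X x y) = vadd Y (T x) (T y)) \<and>
     (\<forall>a. \<forall>x\<in>vcarrier X. T (vscale X a x) = vscale Y a (T x)))"

text \<open>
  The quotient of cocycles by coboundaries; its elements are the cosets \<open>\<phi> + B\<close>. Adding \<open>B\<close> in the
  scalar multiplication matters for the scalar \<open>0\<close>, where the result must be \<open>B\<close> and not \<open>{0}\<close>.
\<close>

definition cohomology :: "('a, 'e::euclidean_space) manifold \<Rightarrow> ('a \<Rightarrow> real) \<Rightarrow> ('a, 'e) form \<Rightarrow> nat \<Rightarrow>
    ('a, 'e) form set vspace" where
  "cohomology M f \<theta> r = (let B = coboundaries M f \<theta> r in
     \<lparr>vcarrier = {{\<phi> + \<beta> | \<beta>. \<beta> \<in> B} | \<phi>. \<phi> \<in> cocycles M f \<theta> r},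
      vadd = (\<lambda>P Q. {\<phi> + \<psi> | \<phi> \<psi>. \<phi> \<in> P \<and> \<psi> \<in> Q}),
      vscale = (\<lambda>a P. {form_scale a \<phi> + \<beta> | \<phi> \<beta>. \<phi> \<in> P \<and> \<beta> \<in> B})\<rparr>)"

end

theory Submission
  imports Defs
begin

text \<open>
  Multiplication by \<open>h\<^sup>r\<close> is a linear bijection on \<open>r\<close>-forms, as \<open>h\<close> does not vanish. By the Leibniz
  rule it intertwines the two differentials up to a unit:
  \<open>d\<^bsub>fh,\<theta>\<^esub> (h\<^sup>r \<phi>) = f h (r h\<^bsup>r-1\<^esup> dh \<and> \<phi> + h\<^sup>r d\<phi>) - r (f dh + h df) \<and> h\<^sup>r \<phi> - f h \<theta> \<and> h\<^sup>r \<phi> = h\<^bsup>r+1\<^esup> d\<^bsub>f,\<theta>\<^esub> \<phi>\<close>,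
  so it maps cocycles onto cocycles and coboundaries onto coboundaries.
\<close>

section \<open>Smooth functions on open subsets of a subspace\<close>

text \<open>The line stays in \<open>V\<close> because \<open>V\<close> is a subspace, and in the
  ambient open set that cuts out \<open>U\<close> by continuity. So derivatives at 0 along
  \<open>V\<close> see only values on \<open>U\<close>.\<close>

lemma eventually_line_in_open:
  fixes x u :: "'e::real_normed_vector"
  assumes "openin (top_of_set V) U" "subspace V" "x \<in> U" "u \<in> V"
  shows "\<forall>\<^sub>F t::real in nhds 0. x + t *\<^sub>R u \<in> U"
proof -
  obtain W where W: "open W" "U = V \<inter> W"
    using assms(1) by (auto simp: openin_open)
  have "((\<lambda>t::real. x + t *\<^sub>R u) \<longlongrightarrow> x + 0 *\<^sub>R u) (nhds 0)"
    by (intro tendsto_intros filterlim_ident)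
  then have "\<forall>\<^sub>F t::real in nhds 0. x + t *\<^sub>R u \<in> W"
    using W assms(3) by (intro topological_tendstoD) auto
  then show ?thesis
    by eventually_elim (use W assms in \<open>auto intro!: subspace_add subspace_scale\<close>)
qed

lemma has_dir_deriv:
  assumes "(\<lambda>t::real. g (x + t *\<^sub>R u)) differentiable (at 0)"
  shows "((\<lambda>t. g (x + t *\<^sub>R u)) has_vector_derivative dir_deriv g x u) (at 0)"
  using assms vector_derivative_works unfolding dir_deriv_def by blast

lemma dir_deriv_eqI:
  assumes "((\<lambda>t::real. g (x + t *\<^sub>R u)) has_vector_derivative D) (at 0)"
  shows "dir_deriv g x u = D"
  using assms unfolding dir_deriv_def by (rule vector_derivative_at)

lemma has_dir_deriv_cong:
  fixes g g' :: "'e::real_normed_vector \<Rightarrow> 'b::real_normed_vector"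
  assumes "openin (top_of_set V) U" "subspace V" "x \<in> U" "u \<in> V" "\<And>y. y \<in> U \<Longrightarrow> g y = g' y"
  shows "((\<lambda>t::real. g (x + t *\<^sub>R u)) has_vector_derivative D) (at 0) \<longleftrightarrow>
    ((\<lambda>t::real. g' (x + t *\<^sub>R u)) has_vector_derivative D) (at 0)"
proof (rule has_vector_derivative_cong_ev)
  show "\<forall>\<^sub>F t::real in nhds 0. t \<in> UNIV \<longrightarrow> g (x + t *\<^sub>R u) = g' (x + t *\<^sub>R u)"
    using eventually_line_in_open[OF assms(1-4)] by eventually_elim (simp add: assms(5))
qed (simp add: assms)

text \<open>\<open>vector_derivative\<close> chooses some \<open>D\<close> satisfying
  \<open>has_vector_derivative\<close>. Both functions satisfy this predicate for the same
  \<open>D\<close>, so the choices agree even where no derivative exists.\<close>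

lemma dir_deriv_cong:
  fixes g g' :: "'e::real_normed_vector \<Rightarrow> 'b::real_normed_vector"
  assumes "openin (top_of_set V) U" "subspace V" "x \<in> U" "u \<in> V" "\<And>y. y \<in> U \<Longrightarrow> g y = g' y"
  shows "dir_deriv g x u = dir_deriv g' x u"
proof -
  have "((\<lambda>t::real. g (x + t *\<^sub>R u)) has_vector_derivative D) (at 0) \<longleftrightarrow>
      ((\<lambda>t::real. g' (x + t *\<^sub>R u)) has_vector_derivative D) (at 0)" for D
    by (rule has_dir_deriv_cong[OF assms(1-4)]) (rule assms(5))
  then show ?thesis
    unfolding dir_deriv_def vector_derivative_def by simp
qed

text \<open>Formulas such as the product rule for \<open>dir_deriv\<close> hold only at points of
  \<open>U\<close>, while \<open>Ck_on\<close> takes total functions; this lemma bridges the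
  gap.\<close>

lemma Ck_on_cong:
  assumes "openin (top_of_set V) U" "subspace V" "\<And>y. y \<in> U \<Longrightarrow> g y = g' y"
  shows "Ck_on k V U g \<longleftrightarrow> Ck_on k V U g'"
  using assms(3)
proof (induction k arbitrary: g g')
  case 0
  then show ?case by (simp cong: continuous_on_cong)
next
  case (Suc k)
  have "(\<lambda>t::real. g (x + t *\<^sub>R u)) differentiable (at 0) \<longleftrightarrow>
      (\<lambda>t::real. g' (x + t *\<^sub>R u)) differentiable (at 0)" if "u \<in> V" "x \<in> U" for u x
  proof -
    have "((\<lambda>t::real. g (x + t *\<^sub>R u)) has_vector_derivative D) (at 0) \<longleftrightarrow>
        ((\<lambda>t::real. g' (x + t *\<^sub>R u)) has_vector_derivative D) (at 0)" for D
      by (rule has_dir_deriv_cong[OF assms(1,2) that(2,1)]) (rule Suc.prems)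
    then show ?thesis
      by (meson vector_derivative_works differentiableI_vector)
  qed
  moreover have "Ck_on k V U (\<lambda>x. dir_deriv g x u) \<longleftrightarrow> Ck_on k V U (\<lambda>x. dir_deriv g' x u)"
    if "u \<in> V" for u
    by (rule Suc.IH) (rule dir_deriv_cong[OF assms(1,2) _ that], assumption, rule Suc.prems)
  ultimately show ?case
    using Suc.prems by (simp cong: continuous_on_cong)
qed

lemma Ck_on_mono:
  "Ck_on (Suc k) V U g \<Longrightarrow> Ck_on k V U g"
  by (induction k arbitrary: g) auto

section \<open>Closure of C^k functions under sums, products and inverses\<close>

lemma Ck_on_add:
  assumes "openin (top_of_set V) U" "subspace V" "Ck_on k V U g" "Ck_on k V U g'"
  shows "Ck_on k V U (\<lambda>x. g x + g' x)"
  using assms(3,4)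
proof (induction k arbitrary: g g')
  case 0
  then show ?case by (auto intro: continuous_on_add)
next
  case (Suc k)
  have D: "((\<lambda>t::real. g (x + t *\<^sub>R u) + g' (x + t *\<^sub>R u)) has_vector_derivative
      dir_deriv g x u + dir_deriv g' x u) (at 0)" if "u \<in> V" "x \<in> U" for u x
    using Suc.prems that by (intro has_vector_derivative_add has_dir_deriv) auto
  have "Ck_on k V U (\<lambda>x. dir_deriv (\<lambda>x. g x + g' x) x u)" if "u \<in> V" for u
  proof -
    have "Ck_on k V U (\<lambda>x. dir_deriv g x u + dir_deriv g' x u)"
      using Suc.prems that by (intro Suc.IH) auto
    then show ?thesis
      using Ck_on_cong[OF assms(1,2), of "\<lambda>x. dir_deriv (\<lambda>x. g x + g' x) x u"
          "\<lambda>x. dir_deriv g x u + dir_deriv g' x u" k] dir_deriv_eqI[OF D[OF that]] by blast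
  qed
  then show ?case
    using Suc.prems D by (auto intro: continuous_on_add differentiableI_vector)
qed

lemma has_dir_deriv_mult:
  fixes g g' :: "'e::real_normed_vector \<Rightarrow> 'b::real_normed_algebra"
  assumes "(\<lambda>t::real. g (x + t *\<^sub>R u)) differentiable (at 0)"
    and "(\<lambda>t::real. g' (x + t *\<^sub>R u)) differentiable (at 0)"
  shows "((\<lambda>t::real. g (x + t *\<^sub>R u) * g' (x + t *\<^sub>R u)) has_vector_derivative
    g x * dir_deriv g' x u + dir_deriv g x u * g' x) (at 0)"
  using has_vector_derivative_mult[OF has_dir_deriv[OF assms(1)] has_dir_deriv[OF assms(2)]] by simp

text \<open>By the product rule the derivative is a sum of products of C^k factors, the
  undifferentiated ones by \<open>Ck_on_mono\<close>. The induction varies \<open>g\<close> and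
  \<open>g'\<close> since derivatives take their place.\<close>

lemma Ck_on_mult:
  fixes g g' :: "'e::real_normed_vector \<Rightarrow> 'b::real_normed_algebra"
  assumes "openin (top_of_set V) U" "subspace V" "Ck_on k V U g" "Ck_on k V U g'"
  shows "Ck_on k V U (\<lambda>x. g x * g' x)"
  using assms(3,4)
proof (induction k arbitrary: g g')
  case 0
  then show ?case by (auto intro: continuous_on_mult)
next
  case (Suc k)
  have D: "((\<lambda>t::real. g (x + t *\<^sub>R u) * g' (x + t *\<^sub>R u)) has_vector_derivative
      g x * dir_deriv g' x u + dir_deriv g x u * g' x) (at 0)" if "u \<in> V" "x \<in> U" for u x
    using Suc.prems that by (intro has_dir_deriv_mult) auto
  have "Ck_on k V U (\<lambda>x. dir_deriv (\<lambda>x. g x * g' x) x u)" if "u \<in> V" for u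
  proof -
    have "Ck_on k V U (\<lambda>x. g x * dir_deriv g' x u + dir_deriv g x u * g' x)"
      using Suc.prems that Ck_on_mono
      by (intro Ck_on_add[OF assms(1,2)] Suc.IH) (auto simp del: Ck_on.simps(1))
    then show ?thesis
      using Ck_on_cong[OF assms(1,2), of "\<lambda>x. dir_deriv (\<lambda>x. g x * g' x) x u"
          "\<lambda>x. g x * dir_deriv g' x u + dir_deriv g x u * g' x" k]
        dir_deriv_eqI[OF D[OF that]] by blast
  qed
  then show ?case
    using Suc.prems D by (auto intro: continuous_on_mult differentiableI_vector)
qed

lemma Ck_on_const: "Ck_on k V U (\<lambda>_. c)"
proof (induction k arbitrary: c)
  case (Suc k)
  have "(\<lambda>x. dir_deriv (\<lambda>_. c) x u) = (\<lambda>_. 0)" for u :: 'a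
    by (intro ext dir_deriv_eqI) simp
  with Suc show ?case by simp
qed simp

text \<open>The derivative of the inverse is built from the inverse itself and the derivative of
  \<open>g\<close>, so the induction hypothesis for the same \<open>g\<close>, one order lower,
  suffices.\<close>

lemma Ck_on_inverse:
  fixes g :: "'e::real_normed_vector \<Rightarrow> real"
  assumes "openin (top_of_set V) U" "subspace V" "Ck_on k V U g" "\<And>x. x \<in> U \<Longrightarrow> g x \<noteq> 0"
  shows "Ck_on k V U (\<lambda>x. inverse (g x))"
  using assms(3,4)
proof (induction k)
  case 0
  then show ?case by (auto intro: continuous_on_inverse)
next
  case (Suc k)
  have D: "((\<lambda>t::real. inverse (g (x + t *\<^sub>R u))) has_vector_derivative
      (- 1) * (inverse (g x) * dir_deriv g x u * inverse (g x))) (at 0)" if "u \<in> V" "x \<in> U" for u x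
  proof -
    have "((\<lambda>t::real. g (x + t *\<^sub>R u)) has_real_derivative dir_deriv g x u) (at 0)"
      using Suc.prems that
      by (auto simp: has_real_derivative_iff_has_vector_derivative intro!: has_dir_deriv)
    from DERIV_inverse'[OF this] show ?thesis
      using Suc.prems that by (simp add: has_real_derivative_iff_has_vector_derivative)
  qed
  have IH: "Ck_on k V U (\<lambda>x. inverse (g x))"
    using Suc Ck_on_mono by blast
  have "Ck_on k V U (\<lambda>x. dir_deriv (\<lambda>x. inverse (g x)) x u)" if "u \<in> V" for u
  proof -
    \<comment> \<open>The sign is written as a constant factor so that closure under products covers
      it.\<close>
    have "Ck_on k V U (\<lambda>x. (- 1) * (inverse (g x) * dir_deriv g x u * inverse (g x)))"
      using Suc.prems that by (intro Ck_on_mult[OF assms(1,2)] Ck_on_const IH) auto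
    then show ?thesis
      using Ck_on_cong[OF assms(1,2), of "\<lambda>x. dir_deriv (\<lambda>x. inverse (g x)) x u"
          "\<lambda>x. (- 1) * (inverse (g x) * dir_deriv g x u * inverse (g x))" k]
        dir_deriv_eqI[OF D[OF that]] by blast
  qed
  then show ?case
    using Suc.prems D by (auto intro: continuous_on_inverse differentiableI_vector)
qed

lemma smooth_on_mult:
  fixes g g' :: "'e::real_normed_vector \<Rightarrow> 'b::real_normed_algebra"
  assumes "openin (top_of_set V) U" "subspace V" "smooth_on V U g" "smooth_on V U g'"
  shows "smooth_on V U (\<lambda>x. g x * g' x)"
  using assms unfolding smooth_on_def by (blast intro: Ck_on_mult)

lemma smooth_on_inverse:
  fixes g :: "'e::real_normed_vector \<Rightarrow> real"
  assumes "openin (top_of_set V) U" "subspace V" "smooth_on V U g" "\<And>x. x \<in> U \<Longrightarrow> g x \<noteq> 0"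
  shows "smooth_on V U (\<lambda>x. inverse (g x))"
  using assms unfolding smooth_on_def by (blast intro: Ck_on_inverse)

lemma smooth_on_differentiable:
  assumes "smooth_on V U g" "x \<in> U" "u \<in> V"
  shows "(\<lambda>t::real. g (x + t *\<^sub>R u)) differentiable (at 0)"
  using assms unfolding smooth_on_def by (auto dest: spec[of _ "Suc 0"])

section \<open>Smooth functions on a manifold\<close>

lemma
  assumes M: "smooth_manifold M"
  shows smooth_manifold_subspace: "subspace (model M)"
    and openin_img: "c \<in> atlas M \<Longrightarrow> openin (top_of_set (model M)) (img c)"
    and openin_dom: "c \<in> atlas M \<Longrightarrow> openin (mtop M) (dom c)"
    and homeomorphic_map_chart: "c \<in> atlas M \<Longrightarrow>
      homeomorphic_map (subtopology (mtop M) (dom c)) (top_of_set (img c)) (snd c)"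
  using M by (simp_all add: smooth_manifold_def)

lemma inj_on_chart:
  assumes "smooth_manifold M" "c \<in> atlas M"
  shows "inj_on (snd c) (dom c)"
proof -
  \<comment> \<open>A homeomorphic map is injective on the underlying set of its source; openness of
    \<open>dom c\<close> makes that set all of \<open>dom c\<close>.\<close>
  have "topspace (subtopology (mtop M) (dom c)) = dom c"
    using openin_subset[OF openin_dom[OF assms]] by (simp add: Int_absorb1)
  with homeomorphic_map_chart[OF assms] show ?thesis
    by (metis homeomorphic_imp_injective_map)
qed

lemma param_in_dom: "x \<in> img c \<Longrightarrow> param c x \<in> dom c"
  by (rule inv_into_into)

lemma param_in_topspace:
  "smooth_manifold M \<Longrightarrow> c \<in> atlas M \<Longrightarrow> x \<in> img c \<Longrightarrow> param c x \<in> topspace (mtop M)"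
  using openin_subset[OF openin_dom] param_in_dom by (metis subsetD)

text \<open>Both coordinate points describe the same point of \<open>M\<close>. Hence a function
  takes the same value in either chart, and multiplying by it respects the pullback condition on
  forms.\<close>

lemma param_transition:
  assumes "smooth_manifold M" "c \<in> atlas M" "c' \<in> atlas M" "x \<in> overlap c c'"
  shows "param c' (transition c c' x) = param c x"
proof -
  obtain p where "p \<in> dom c" "p \<in> dom c'" "x = snd c p"
    using assms(4) unfolding overlap_def by auto
  then show ?thesis
    using inj_on_chart[OF assms(1,2)] inj_on_chart[OF assms(1,3)] by (simp add: transition_def)
qed

lemma smooth_functions_mult:
  assumes "smooth_manifold M" "f \<in> smooth_functions M" "g \<in> smooth_functions M"
  shows "(\<lambda>p. f p * g p) \<in> smooth_functions M"
proof -
  have "smooth_on (model M) (img c) (\<lambda>x. f (param c x) * g (param c x))" if "c \<in> atlas M" for c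
    using assms(2,3) that
    by (intro smooth_on_mult[OF openin_img[OF assms(1) that] smooth_manifold_subspace[OF assms(1)]])
      (auto simp: smooth_functions_def o_def)
  then show ?thesis
    by (simp add: smooth_functions_def o_def)
qed

lemma smooth_functions_power:
  assumes "smooth_manifold M" "f \<in> smooth_functions M"
  shows "(\<lambda>p. f p ^ n) \<in> smooth_functions M"
proof (induction n)
  case 0
  then show ?case by (simp add: smooth_functions_def smooth_on_def o_def Ck_on_const)
next
  case (Suc n)
  then show ?case using smooth_functions_mult[OF assms] by simp
qed

lemma smooth_functions_inverse:
  assumes "smooth_manifold M" "f \<in> smooth_functions M" "\<forall>p\<in>topspace (mtop M). f p \<noteq> 0"
  shows "(\<lambda>p. inverse (f p)) \<in> smooth_functions M"
proof -
  have "smooth_on (model M) (img c) (\<lambda>x. inverse (f (param c x)))" if "c \<in> atlas M" for c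
    using assms(2,3) that param_in_topspace[OF assms(1) that]
    by (intro smooth_on_inverse[OF openin_img[OF assms(1) that] smooth_manifold_subspace[OF assms(1)]])
      (auto simp: smooth_functions_def o_def)
  then show ?thesis
    by (simp add: smooth_functions_def o_def)
qed

lemma smooth_functions_differentiable:
  assumes "f \<in> smooth_functions M" "c \<in> atlas M" "x \<in> img c" "u \<in> model M"
  shows "(\<lambda>t::real. f (param c (x + t *\<^sub>R u))) differentiable (at 0)"
proof -
  have "smooth_on (model M) (img c) (f \<circ> param c)"
    using assms by (auto simp: smooth_functions_def)
  from smooth_on_differentiable[OF this assms(3,4)] show ?thesis by (simp add: o_def)
qed

section \<open>Multiplication of forms by smooth functions\<close>

lemma fun_mult_in_forms:
  assumes M: "smooth_manifold M" and g: "g \<in> smooth_functions M" and \<omega>: "\<omega> \<in> forms M r"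
  shows "fun_mult g \<omega> \<in> forms M r"
proof -
  have "alternating_multilinear (model M) r (fun_mult g \<omega> c x)" if "c \<in> atlas M" "x \<in> img c" for c x
  proof -
    have "alternating_multilinear (model M) r (\<omega> c x)"
      using \<omega> that by (auto simp: forms_def)
    then show ?thesis
      unfolding alternating_multilinear_def fun_mult_def by (simp add: algebra_simps)
  qed
  moreover have "smooth_on (model M) (img c) (\<lambda>x. fun_mult g \<omega> c x us)"
    if "c \<in> atlas M" "length us = r" "set us \<subseteq> model M" for c us
    unfolding fun_mult_def
  proof (rule smooth_on_mult[OF openin_img[OF M that(1)] smooth_manifold_subspace[OF M]])
    show "smooth_on (model M) (img c) (\<lambda>x. g (param c x))"
      using g that by (auto simp: smooth_functions_def o_def)
    show "smooth_on (model M) (img c) (\<lambda>x. \<omega> c x us)"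
      using \<omega> that unfolding forms_def by blast
  qed
  moreover have "fun_mult g \<omega> c x us =
      fun_mult g \<omega> c' (transition c c' x) (map (dir_deriv (transition c c') x) us)"
    if "c \<in> atlas M" "c' \<in> atlas M" "x \<in> overlap c c'" "length us = r" "set us \<subseteq> model M" for c c' x us
  proof -
    have "\<omega> c x us = \<omega> c' (transition c c' x) (map (dir_deriv (transition c c') x) us)"
      using \<omega> that unfolding forms_def by blast
    then show ?thesis
      using that by (simp add: fun_mult_def param_transition[OF M])
  qed
  moreover have "\<forall>c x us. \<not> (valid_args M c x us \<and> length us = r) \<longrightarrow> fun_mult g \<omega> c x us = 0"
    using \<omega> by (simp add: fun_mult_def forms_def)
  ultimately show ?thesis
    unfolding forms_def by blast
qed

section \<open>Algebra of multiplication by functions and the wedge product\<close>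

lemma fun_mult_add: "fun_mult g (\<phi> + \<psi>) = fun_mult g \<phi> + fun_mult g \<psi>"
  by (simp add: fun_mult_def fun_eq_iff algebra_simps)

lemma fun_mult_0: "fun_mult g 0 = 0"
  by (simp add: fun_mult_def fun_eq_iff)

text \<open>With one function constant, this is homogeneity with respect to
  \<open>form_scale\<close>.\<close>

lemma fun_mult_commute: "fun_mult g (fun_mult h \<phi>) = fun_mult h (fun_mult g \<phi>)"
  by (simp add: fun_mult_def fun_eq_iff)

lemma wedge1_fun_mult_left: "wedge1 (fun_mult g \<alpha>) \<phi> = fun_mult g (wedge1 \<alpha> \<phi>)"
  by (simp add: wedge1_def fun_mult_def fun_eq_iff sum_distrib_left mult_ac)

lemma wedge1_fun_mult_right: "wedge1 \<alpha> (fun_mult g \<phi>) = fun_mult g (wedge1 \<alpha> \<phi>)"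
  by (simp add: wedge1_def fun_mult_def fun_eq_iff sum_distrib_left mult_ac)

lemma wedge1_add_left: "wedge1 (\<alpha> + \<beta>) \<phi> = wedge1 \<alpha> \<phi> + wedge1 \<beta> \<phi>"
  by (simp add: wedge1_def fun_eq_iff algebra_simps sum.distrib)

text \<open>
  Enough for multiplication by a nonvanishing function to be injective, and obviously preserved by
  \<open>d\<^bsub>f,\<theta>\<^esub>\<close>, so that the smoothness and chart independence of \<open>d\<^bsub>f,\<theta>\<^esub> \<phi>\<close> are never needed.
\<close>

definition supported :: "('a, 'e) manifold \<Rightarrow> ('a, 'e) form \<Rightarrow> bool" where
  "supported M \<omega> \<longleftrightarrow> (\<forall>c x us. \<omega> c x us \<noteq> 0 \<longrightarrow> c \<in> atlas M \<and> x \<in> img c)"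

lemma supported_forms: "\<omega> \<in> forms M r \<Longrightarrow> supported M \<omega>"
  unfolding supported_def forms_def valid_args_def by blast

lemma supported_0: "supported M 0"
  by (simp add: supported_def)

lemma supported_add: "supported M \<phi> \<Longrightarrow> supported M \<psi> \<Longrightarrow> supported M (\<phi> + \<psi>)"
  unfolding supported_def plus_fun_apply by (metis add.right_neutral)

text \<open>The wedge terms evaluate \<phi> at the same chart and point, where it vanishes on every
  list; the derivative term vanishes by the guard in \<open>ext_d\<close>.\<close>

lemma supported_d_f_theta:
  assumes "supported M \<phi>"
  shows "supported M (d_f_theta M f \<theta> r \<phi>)"
proof -
  have "d_f_theta M f \<theta> r \<phi> c x us = 0" if "\<not> (c \<in> atlas M \<and> x \<in> img c)" for c x us
  proof -
    have "\<phi> c x vs = 0" for vs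
      using assms that unfolding supported_def by blast
    then show ?thesis
      using that by (auto simp: d_f_theta_def d_f_def fun_mult_def wedge1_def ext_d_def valid_args_def)
  qed
  then show ?thesis unfolding supported_def by blast
qed

lemma supported_coboundaries: "\<phi> \<in> coboundaries M f \<theta> r \<Longrightarrow> supported M \<phi>"
  by (cases r) (auto simp: supported_0 intro: supported_d_f_theta supported_forms)

lemma fun_mult_inj:
  assumes M: "smooth_manifold M" and g: "\<forall>p\<in>topspace (mtop M). g p \<noteq> 0"
    and "supported M \<phi>" "supported M \<psi>" "fun_mult g \<phi> = fun_mult g \<psi>"
  shows "\<phi> = \<psi>"
proof (intro ext)
  fix c x us
  show "\<phi> c x us = \<psi> c x us"
  proof (cases "c \<in> atlas M \<and> x \<in> img c")
    case True
    then have "g (param c x) \<noteq> 0"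
      using g param_in_topspace[OF M] by blast
    moreover have "g (param c x) * \<phi> c x us = g (param c x) * \<psi> c x us"
      using assms(5) by (metis fun_mult_def)
    ultimately show ?thesis by simp
  next
    \<comment> \<open>Here \<open>param c x\<close> may be an arbitrary point where \<open>g\<close>
      could vanish, so equality comes from both forms being 0.\<close>
    case False
    then show ?thesis
      using assms(3,4) unfolding supported_def by metis
  qed
qed

lemma fun_mult_forms_onto:
  assumes M: "smooth_manifold M" and g: "g \<in> smooth_functions M"
    and nz: "\<forall>p\<in>topspace (mtop M). g p \<noteq> 0"
  shows "fun_mult g ` forms M r = forms M r"
proof (intro equalityI subsetI)
  fix \<psi>
  assume \<psi>: "\<psi> \<in> forms M r"
  \<comment> \<open>The preimage is \<psi> divided by \<open>g\<close>. Where \<psi> is nonzero,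
    \<open>param c x\<close> lies in \<open>M\<close> and the division cancels; elsewhere both sides
    are 0.\<close>
  have "fun_mult g (fun_mult (\<lambda>p. inverse (g p)) \<psi>) = \<psi>"
  proof (intro ext)
    fix c x us
    have "g (param c x) \<noteq> 0" if "\<psi> c x us \<noteq> 0"
      using supported_forms[OF \<psi>] nz param_in_topspace[OF M] that unfolding supported_def by blast
    then show "fun_mult g (fun_mult (\<lambda>p. inverse (g p)) \<psi>) c x us = \<psi> c x us"
      by (cases "\<psi> c x us = 0") (auto simp: fun_mult_def)
  qed
  then show "\<psi> \<in> fun_mult g ` forms M r"
    using fun_mult_in_forms[OF M smooth_functions_inverse[OF M g nz] \<psi>] by (metis imageI)
qed (use fun_mult_in_forms[OF M g] in auto)

section \<open>The Leibniz rule\<close>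

lemma ext_d_fun_form:
  assumes M: "smooth_manifold M"
  shows "ext_d M (fun_form M g) c x us =
    (if valid_args M c x us \<and> length us = 1 then dir_deriv (\<lambda>y. g (param c y)) x (us ! 0) else 0)"
proof (cases "valid_args M c x us")
  case True
  then have c: "c \<in> atlas M" "x \<in> img c" "set us \<subseteq> model M"
    by (auto simp: valid_args_def)
  show ?thesis
  proof (cases "length us = 1")
    case True
    then obtain u where us: "us = [u]"
      by (metis One_nat_def length_0_conv length_Suc_conv)
    \<comment> \<open>The guard in \<open>fun_form\<close> holds on all of \<open>img c\<close>,
      which is relatively open, so it does not affect the derivative.\<close>
    have "dir_deriv (\<lambda>y. fun_form M g c y []) x u = dir_deriv (\<lambda>y. g (param c y)) x u"
      using c us
      by (intro dir_deriv_cong[OF openin_img[OF M c(1)] smooth_manifold_subspace[OF M]])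
        (auto simp: fun_form_def valid_args_def)
    then show ?thesis
      using us \<open>valid_args M c x us\<close> by (simp add: ext_d_def omit_def)
  next
    case False
    have "dir_deriv (\<lambda>y. fun_form M g c y (omit i us)) x (us ! i) = 0" if "i < length us" for i
    proof -
      \<comment> \<open>An index \<open>i\<close> exists and the length is not 1, so at least two
        entries are present and one survives the omission.\<close>
      have "length (omit i us) \<noteq> 0"
        using that False by (simp add: omit_def)
      then have "(\<lambda>y. fun_form M g c y (omit i us)) = (\<lambda>_. 0)"
        by (auto simp: fun_form_def)
      then show ?thesis
        by (auto intro: dir_deriv_eqI)
    qed
    with False show ?thesis by (simp add: ext_d_def)
  qed
qed (simp add: ext_d_def)

lemma ext_d_fun_form_mult:
  assumes M: "smooth_manifold M" and f: "f \<in> smooth_functions M" and g: "g \<in> smooth_functions M"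
  shows "ext_d M (fun_form M (\<lambda>p. f p * g p)) =
    fun_mult f (ext_d M (fun_form M g)) + fun_mult g (ext_d M (fun_form M f))"
proof (intro ext)
  fix c x and us :: "'b list"
  have "dir_deriv (\<lambda>y. f (param c y) * g (param c y)) x (us ! 0) =
      f (param c x) * dir_deriv (\<lambda>y. g (param c y)) x (us ! 0) +
      dir_deriv (\<lambda>y. f (param c y)) x (us ! 0) * g (param c x)"
    if "valid_args M c x us" "length us = 1"
    using that f g
    by (intro dir_deriv_eqI has_dir_deriv_mult smooth_functions_differentiable)
      (auto simp: valid_args_def subset_iff)
  then show "ext_d M (fun_form M (\<lambda>p. f p * g p)) c x us =
      (fun_mult f (ext_d M (fun_form M g)) + fun_mult g (ext_d M (fun_form M f))) c x us"
    by (simp add: ext_d_fun_form[OF M] fun_mult_def)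
qed

text \<open>The factor \<open>h\<close> on the left avoids the exponent \<open>n - 1\<close>.\<close>

lemma ext_d_fun_form_power:
  assumes M: "smooth_manifold M" and h: "h \<in> smooth_functions M"
  shows "fun_mult h (ext_d M (fun_form M (\<lambda>p. h p ^ n))) =
    fun_mult (\<lambda>p. real n * h p ^ n) (ext_d M (fun_form M h))"
proof (induction n)
  case 0
  have "ext_d M (fun_form M (\<lambda>_. 1)) = 0"
    by (auto simp: fun_eq_iff ext_d_fun_form[OF M] intro!: dir_deriv_eqI)
  then show ?case by (simp add: fun_mult_def fun_eq_iff)
next
  case (Suc n)
  \<comment> \<open>The Leibniz rule for \<open>h\<close> times \<open>h p ^ n\<close>; the first
    summand contains the left side of the induction hypothesis.\<close>
  have "fun_mult h (ext_d M (fun_form M (\<lambda>p. h p ^ Suc n))) =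
      fun_mult h (fun_mult h (ext_d M (fun_form M (\<lambda>p. h p ^ n)))) +
      fun_mult h (fun_mult (\<lambda>p. h p ^ n) (ext_d M (fun_form M h)))"
    by (simp add: ext_d_fun_form_mult[OF M h smooth_functions_power[OF M h]] fun_mult_add)
  also have "\<dots> = fun_mult (\<lambda>p. real (Suc n) * h p ^ Suc n) (ext_d M (fun_form M h))"
    unfolding Suc.IH by (simp add: fun_mult_def fun_eq_iff algebra_simps)
  finally show ?case .
qed

text \<open>The product rule is applied to each summand of \<open>ext_d\<close>: differentiating the
  coefficient gives the first term, differentiating \<open>g\<close> gives the wedge term with the
  same sign.\<close>

lemma ext_d_fun_mult:
  assumes M: "smooth_manifold M" and g: "g \<in> smooth_functions M" and \<phi>: "\<phi> \<in> forms M r"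
  shows "ext_d M (fun_mult g \<phi>) = fun_mult g (ext_d M \<phi>) + wedge1 (ext_d M (fun_form M g)) \<phi>"
proof (intro ext)
  fix c x and us :: "'b list"
  show "ext_d M (fun_mult g \<phi>) c x us =
      (fun_mult g (ext_d M \<phi>) + wedge1 (ext_d M (fun_form M g)) \<phi>) c x us"
  proof (cases "valid_args M c x us")
    case True
    then have c: "c \<in> atlas M" "x \<in> img c" "set us \<subseteq> model M"
      by (auto simp: valid_args_def)
    have "dir_deriv (\<lambda>y. fun_mult g \<phi> c y (omit i us)) x (us ! i) =
        g (param c x) * dir_deriv (\<lambda>y. \<phi> c y (omit i us)) x (us ! i) +
        ext_d M (fun_form M g) c x [us ! i] * \<phi> c x (omit i us)" if i: "i < length us" for i
    proof -
      have u: "us ! i \<in> model M"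
        using c i by auto
      have "(\<lambda>t::real. \<phi> c (x + t *\<^sub>R (us ! i)) (omit i us)) differentiable (at 0)"
      proof (cases "length (omit i us) = r")
        case True
        moreover have "set (omit i us) \<subseteq> model M"
          using c(3) set_take_subset[of i us] set_drop_subset[of "Suc i" us] by (auto simp: omit_def)
        ultimately have "smooth_on (model M) (img c) (\<lambda>y. \<phi> c y (omit i us))"
          using \<phi> c by (auto simp: forms_def)
        from smooth_on_differentiable[OF this c(2) u] show ?thesis .
      next
        \<comment> \<open>On lists of the wrong length \<phi> is identically 0, hence
          differentiable.\<close>
        case False
        then have "\<phi> c y (omit i us) = 0" for y
          using \<phi> unfolding forms_def by blast
        then show ?thesis by simp
      qed
      from dir_deriv_eqI[OF has_dir_deriv_mult[OF smooth_functions_differentiable[OF g c(1,2) u] this]]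
      show ?thesis
        using c u by (simp add: fun_mult_def ext_d_fun_form[OF M] valid_args_def)
    qed
    then have "ext_d M (fun_mult g \<phi>) c x us =
        (\<Sum>i<length us. (- 1) ^ i *
          (g (param c x) * dir_deriv (\<lambda>y. \<phi> c y (omit i us)) x (us ! i) +
           ext_d M (fun_form M g) c x [us ! i] * \<phi> c x (omit i us)))"
      using True by (simp add: ext_d_def[of M "fun_mult g \<phi>"])
    also have "\<dots> = (fun_mult g (ext_d M \<phi>) + wedge1 (ext_d M (fun_form M g)) \<phi>) c x us"
      using True by (simp add: ext_d_def[of M \<phi>] wedge1_def fun_mult_def
          sum_distrib_left sum.distrib algebra_simps)
    finally show ?thesis .
  next
    case False
    \<comment> \<open>Unlike \<open>ext_d\<close>, \<open>wedge1\<close> has no guard, so its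
      vanishing on invalid arguments must come from its factors.\<close>
    have "wedge1 (ext_d M (fun_form M g)) \<phi> c x us = 0"
    proof (cases "c \<in> atlas M \<and> x \<in> img c")
      case True
      have "ext_d M (fun_form M g) c x [us ! i] * \<phi> c x (omit i us) = 0" if i: "i < length us" for i
      proof -
        \<comment> \<open>A vector outside the model space is either \<open>us ! i\<close> or among
          the remaining entries, so one of the two factors gets an invalid argument and is
          0.\<close>
        have "set us \<subseteq> insert (us ! i) (set (omit i us))"
          using i id_take_nth_drop[OF i]
          by (metis Un_insert_right list.simps(15) omit_def order_refl set_append)
        then have "\<not> valid_args M c x [us ! i] \<or> \<not> valid_args M c x (omit i us)"
          using False True by (auto simp: valid_args_def)
        moreover have "\<phi> c x (omit i us) = 0" if "\<not> valid_args M c x (omit i us)"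
          using \<phi> that unfolding forms_def by blast
        ultimately show ?thesis
          by (auto simp: ext_d_def)
      qed
      then show ?thesis by (auto simp: wedge1_def intro!: sum.neutral)
    qed (auto simp: wedge1_def ext_d_def valid_args_def)
    moreover have "ext_d M \<psi> c x us = 0" for \<psi>
      using False by (simp add: ext_d_def)
    ultimately show ?thesis by (simp add: fun_mult_def)
  qed
qed

text \<open>The terms in dh cancel: one comes from d(h^r), the other from the factor r d(fh). The
  exponent \<open>Suc r\<close> is the degree of the result, so the multiplications by h^r form a
  cochain map.\<close>

lemma d_f_theta_fun_mult_power:
  assumes M: "smooth_manifold M" and f: "f \<in> smooth_functions M" and h: "h \<in> smooth_functions M"
    and \<phi>: "\<phi> \<in> forms M r"
  shows "d_f_theta M (\<lambda>p. f p * h p) \<theta> r (fun_mult (\<lambda>p. h p ^ r) \<phi>) =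
    fun_mult (\<lambda>p. h p ^ Suc r) (d_f_theta M f \<theta> r \<phi>)"
proof -
  let ?d = "\<lambda>g. ext_d M (fun_form M g)"
  have "fun_mult h (wedge1 (?d (\<lambda>p. h p ^ r)) \<phi>) = fun_mult (\<lambda>p. real r * h p ^ r) (wedge1 (?d h) \<phi>)"
    using ext_d_fun_form_power[OF M h, of r] by (metis wedge1_fun_mult_left)
  from fun_cong[OF fun_cong[OF fun_cong[OF this]]]
  have dh: "h (param c x) * wedge1 (?d (\<lambda>p. h p ^ r)) \<phi> c x us =
      real r * h (param c x) ^ r * wedge1 (?d h) \<phi> c x us" for c x us
    by (simp add: fun_mult_def)
  show ?thesis
    unfolding d_f_theta_def d_f_def ext_d_fun_mult[OF M smooth_functions_power[OF M h] \<phi>]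
      ext_d_fun_form_mult[OF M f h] wedge1_add_left wedge1_fun_mult_left wedge1_fun_mult_right
    by (intro ext) (simp add: fun_mult_def dh algebra_simps)
qed

section \<open>Cohomology\<close>

text \<open>Serves both coset operations: \<open>g x y\<close> is the sum of \<open>x\<close> and
  \<open>y\<close> for \<open>vadd\<close>, and \<open>form_scale a x + y\<close> for
  \<open>vscale\<close>.\<close>

lemma image_setcompr_binary:
  assumes "\<And>x y. F (g x y) = g' (F x) (F y)"
  shows "F ` {g x y | x y. x \<in> P \<and> y \<in> Q} = {g' x y | x y. x \<in> F ` P \<and> y \<in> F ` Q}"
proof -
  have "F ` {g x y | x y. x \<in> P \<and> y \<in> Q} = {F (g x y) | x y. x \<in> P \<and> y \<in> Q}"
    by blast
  also have "\<dots> = {g' x y | x y. x \<in> F ` P \<and> y \<in> F ` Q}"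
    unfolding assms by blast
  finally show ?thesis .
qed

text \<open>The isomorphism sends a coset to its image under \<open>F\<close>. Injectivity of
  \<open>F\<close> is asked only on a set \<open>S\<close> containing all the cosets, since on
  arbitrary families of functions it may fail.\<close>

lemma vspace_iso_quotient_image:
  fixes F :: "('a, 'e::euclidean_space) form \<Rightarrow> ('a, 'e) form"
  assumes add: "\<And>\<phi> \<psi>. F (\<phi> + \<psi>) = F \<phi> + F \<psi>"
    and scale: "\<And>a \<phi>. F (form_scale a \<phi>) = form_scale a (F \<phi>)"
    and inj: "inj_on F S"
    and S: "\<And>\<phi> \<beta>. \<phi> \<in> cocycles M f \<theta> r \<Longrightarrow> \<beta> \<in> coboundaries M f \<theta> r \<Longrightarrow> \<phi> + \<beta> \<in> S"
    and Z: "F ` cocycles M f \<theta> r = cocycles M g \<theta> r"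
    and B: "F ` coboundaries M f \<theta> r = coboundaries M g \<theta> r"
  shows "vspace_iso (cohomology M f \<theta> r) (cohomology M g \<theta> r)"
  unfolding vspace_iso_def
proof (intro exI[of _ "image F"] conjI ballI allI)
  let ?X = "cohomology M f \<theta> r" and ?Y = "cohomology M g \<theta> r"
  have coset: "F ` {\<phi> + \<beta> |\<beta>. \<beta> \<in> coboundaries M f \<theta> r} = {F \<phi> + \<beta> |\<beta>. \<beta> \<in> coboundaries M g \<theta> r}" for \<phi>
    unfolding B[symmetric] Setcompr_eq_image image_image by (simp add: add)
  have "inj_on (image F) (Pow S)"
    using inj by (rule inj_on_image_Pow)
  moreover have "vcarrier ?X \<subseteq> Pow S"
    using S by (auto simp: cohomology_def Let_def)
  ultimately have "inj_on (image F) (vcarrier ?X)"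
    by (rule inj_on_subset)
  moreover have "image F ` vcarrier ?X = vcarrier ?Y"
  proof -
    have "vcarrier ?X = (\<lambda>\<phi>. {\<phi> + \<beta> |\<beta>. \<beta> \<in> coboundaries M f \<theta> r}) ` cocycles M f \<theta> r"
      and "vcarrier ?Y = (\<lambda>\<phi>. {\<phi> + \<beta> |\<beta>. \<beta> \<in> coboundaries M g \<theta> r}) ` cocycles M g \<theta> r"
      by (auto simp: cohomology_def Let_def)
    then show ?thesis
      by (simp only: image_image coset Z[symmetric])
  qed
  ultimately show "bij_betw (image F) (vcarrier ?X) (vcarrier ?Y)"
    by (simp add: bij_betw_def)
  show "F ` vadd ?X P Q = vadd ?Y (F ` P) (F ` Q)" for P Q
    unfolding cohomology_def Let_def vspace.simps by (rule image_setcompr_binary) (rule add)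
  show "F ` vscale ?X a P = vscale ?Y a (F ` P)" for a P
    \<comment> \<open>The target coboundaries are rewritten as the image under \<open>F\<close> of
      the source ones, so that both arguments of the binary operation are images.\<close>
    unfolding cohomology_def Let_def vspace.simps B[symmetric]
    by (rule image_setcompr_binary) (simp add: add scale)
qed

theorem proposition3p2:
  fixes M :: "('a, 'e::euclidean_space) manifold"
    and f h :: "'a \<Rightarrow> real"
    and \<theta> :: "('a, 'e) form"
  assumes "smooth_manifold M"
    and "f \<in> smooth_functions M"
    and "closed_form M 1 \<theta>"
    and "h \<in> smooth_functions M"
    and "\<forall>p\<in>topspace (mtop M). h p \<noteq> 0"
  shows "\<forall>r. vspace_iso (cohomology M f \<theta> r) (cohomology M (\<lambda>p. f p * h p) \<theta> r)"
proof
  fix r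
  note M = assms(1) and f = assms(2) and h = assms(4) and nz = assms(5)
  let ?F = "\<lambda>r. fun_mult (\<lambda>p. h p ^ r) :: ('a, 'e) form \<Rightarrow> ('a, 'e) form"
  let ?fh = "\<lambda>p. f p * h p"
  have onto: "?F k ` forms M k = forms M k" for k
    using nz by (intro fun_mult_forms_onto[OF M smooth_functions_power[OF M h]]) simp
  have inj: "inj_on (?F k) {\<phi>. supported M \<phi>}" for k
    by (intro inj_onI, rule fun_mult_inj[OF M, of "\<lambda>p. h p ^ k"]) (use nz in simp_all)
  have d: "d_f_theta M ?fh \<theta> k (?F k \<phi>) = ?F (Suc k) (d_f_theta M f \<theta> k \<phi>)" if "\<phi> \<in> forms M k" for k \<phi>
    using d_f_theta_fun_mult_power[OF M f h that] .
  have "d_f_theta M ?fh \<theta> r (?F r \<phi>) = 0 \<longleftrightarrow> d_f_theta M f \<theta> r \<phi> = 0" if \<phi>: "\<phi> \<in> forms M r" for \<phi>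
  proof -
    have "supported M (d_f_theta M f \<theta> r \<phi>)"
      using \<phi> by (intro supported_d_f_theta supported_forms)
    \<comment> \<open>Multiplication by h^(r+1) is injective on supported families, so it detects
      whether the differential vanishes.\<close>
    then have "?F (Suc r) (d_f_theta M f \<theta> r \<phi>) = ?F (Suc r) 0 \<longleftrightarrow> d_f_theta M f \<theta> r \<phi> = 0"
      by (intro inj_on_eq_iff[OF inj]) (simp_all only: mem_Collect_eq supported_0)
    then show ?thesis
      unfolding d[OF \<phi>] fun_mult_0 .
  qed
  then have "cocycles M f \<theta> r = {\<phi> \<in> forms M r. d_f_theta M ?fh \<theta> r (?F r \<phi>) = 0}"
    unfolding cocycles_def by (simp cong: conj_cong)
  \<comment> \<open>The cocycle condition is now stated on the image of \<phi>, so it passes through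
    the image; \<open>onto\<close> then identifies the image of the forms with all forms.\<close>
  moreover have "?F r ` {\<phi> \<in> forms M r. P (?F r \<phi>)} = {\<psi> \<in> ?F r ` forms M r. P \<psi>}" for P
    by blast
  ultimately have Z: "?F r ` cocycles M f \<theta> r = cocycles M ?fh \<theta> r"
    by (simp only: onto cocycles_def[of M ?fh])
  have B: "?F r ` coboundaries M f \<theta> r = coboundaries M ?fh \<theta> r"
  proof (cases r)
    case 0
    then show ?thesis by (simp add: fun_mult_0)
  next
    case (Suc k)
    \<comment> \<open>Every k-form is h^k times a k-form; moving h^k past the differential turns it
      into h^(k+1), the multiplier of degree \<open>Suc k\<close>.\<close>
    have "coboundaries M ?fh \<theta> (Suc k) = d_f_theta M ?fh \<theta> k ` ?F k ` forms M k"
      by (simp only: onto coboundaries.simps)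
    also have "\<dots> = ?F (Suc k) ` coboundaries M f \<theta> (Suc k)"
      unfolding coboundaries.simps image_image using d by (rule image_cong[OF refl])
    finally show ?thesis unfolding Suc by (rule sym)
  qed
  show "vspace_iso (cohomology M f \<theta> r) (cohomology M ?fh \<theta> r)"
  proof (rule vspace_iso_quotient_image[OF fun_mult_add fun_mult_commute inj _ Z B])
    fix \<phi> \<beta>
    assume "\<phi> \<in> cocycles M f \<theta> r" "\<beta> \<in> coboundaries M f \<theta> r"
    then have "supported M \<phi>" "supported M \<beta>"
      unfolding cocycles_def by (blast intro: supported_forms supported_coboundaries)+
    then show "\<phi> + \<beta> \<in> {\<phi>. supported M \<phi>}"
      by (simp add: supported_add)
  qed
qed

end
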